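(* Let $d$ be a positive integer. In a combinatorial auction with $n$ bidders and a set $[m]$ of items, if every bidder's valuation belongs to $\max(\mathrm{SAW}\text{-}d)$, then the Simultaneous Item First Price Auction (SIA) has a price of anarchy with respect to coarse correlated equilibria of at most $8d\cdot H_{m/(2d)}$.
   Context: Valuations are normalized ($f(\emptyset)=0$) monotone set functions $f:2^{[m]}\to\mathbb{R}_{\ge0}$. Write $f(S\mid T)=f(S\cup T)-f(T)$. A set $T$ is superadditive w.r.t. $f$ if there exists $S\subseteq[m]\setminus T$ with $f(S\mid T)>\max_{T'\subsetneq T} f(S\mid T')$; $\mathrm{SAW}(f)$ is the maximum cardinality of a nonempty superadditive set (0 if none), and $\mathrm{SAW}\text{-}d$ is the class of such $f$ with $\mathrm{SAW}(f)\le d$. For a class $\mathcal{F}$, $\max(\mathcal{F})$ is the class of functions $f(S)=\max_{i\in[k]} f_i(S)$ for some $k\in\mathbb{N}$ and $f_1,\dots,f_k\in\mathcal{F}$. SIA: each bidder submits a bid on every item; each item is sold to its highest bidder, who pays its bid on that item. Bidders have quasilinear utilities; social welfare is the sum of bidders' values for their received sets. The price of anarchy w.r.t. coarse correlated equilibria is the supremum over valuation profiles in the class and over coarse correlated equilibria of optimal welfare divided by expected equilibrium welfare. $H_x=\sum_{k\in[x]}1/k$, where $[x]=\{k\in\mathbb{Z}:1\le k\le x\}$.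
   Formalization: The formal theorem assumes 2d ≤ m; for 1 ≤ m < 2d the sum H_{m/(2d)} is empty, so the stated bound would be 0, which fails already for identical additive valuations (price of anarchy at least 1). *)

theory Defs
  imports "HOL-Probability.Probability"
begin

text \<open>The item set \<open>[m]\<close> is a finite type \<open>'m\<close> and the set of bidders is a finite type \<open>'n\<close>,
  so \<open>m = CARD('m)\<close> and \<open>n = CARD('n)\<close>.\<close>

definition valuation :: "('m::finite set \<Rightarrow> real) \<Rightarrow> bool" where
  "valuation f \<longleftrightarrow> f {} = 0 \<and> mono f \<and> (\<forall>S. 0 \<le> f S)"

definition marginal :: "('m::finite set \<Rightarrow> real) \<Rightarrow> 'm set \<Rightarrow> 'm set \<Rightarrow> real" where
  "marginal f S T = f (S \<union> T) - f T"

text \<open>Only meaningful for \<open>T \<noteq> {}\<close>, as the maximum otherwise ranges over the empty set;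
  the width below only uses it for nonempty \<open>T\<close>.\<close>

definition superadditive_set :: "('m::finite set \<Rightarrow> real) \<Rightarrow> 'm set \<Rightarrow> bool" where
  "superadditive_set f T \<longleftrightarrow>
     (\<exists>S. S \<subseteq> UNIV - T \<and> marginal f S T > Max {marginal f S T' |T'. T' \<subset> T})"

definition SAW :: "('m::finite set \<Rightarrow> real) \<Rightarrow> nat" where
  "SAW f = Max (insert 0 (card ` {T. T \<noteq> {} \<and> superadditive_set f T}))"

definition SAW_class :: "nat \<Rightarrow> ('m::finite set \<Rightarrow> real) set" where
  "SAW_class d = {f. valuation f \<and> SAW f \<le> d}"

definition max_class :: "('m::finite set \<Rightarrow> real) set \<Rightarrow> ('m set \<Rightarrow> real) set" where
  "max_class F = {f. \<exists>k::nat. \<exists>g. 1 \<le> k \<and> (\<forall>i\<in>{1..k}. g i \<in> F) \<and>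
                       (\<forall>S. f S = Max ((\<lambda>i. g i S) ` {1..k}))}"

text \<open>A bid profile \<open>b\<close> assigns to bidder \<open>i\<close> and item \<open>j\<close> the bid \<open>b i j\<close>.\<close>

type_synonym ('n, 'm) bids = "'n \<Rightarrow> 'm \<Rightarrow> real"

definition bid_space :: "('n::finite, 'm::finite) bids measure" where
  "bid_space = (\<Pi>\<^sub>M i\<in>UNIV. \<Pi>\<^sub>M j\<in>UNIV. borel)"

text \<open>The winner of each item; ties between highest bids may be resolved in an arbitrary
  (measurable) way, depending on the item and on the whole bid profile.\<close>

definition highest_bidder_rule ::
    "(('n::finite, 'm::finite) bids \<Rightarrow> 'm \<Rightarrow> 'n) \<Rightarrow> bool" where
  "highest_bidder_rule w \<longleftrightarrow>
     (\<forall>b j i. b i j \<le> b (w b j) j) \<and>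
     (\<forall>j. (\<lambda>b. w b j) \<in> measurable bid_space (count_space UNIV))"

definition won_items ::
    "(('n::finite, 'm::finite) bids \<Rightarrow> 'm \<Rightarrow> 'n) \<Rightarrow> ('n, 'm) bids \<Rightarrow> 'n \<Rightarrow> 'm set" where
  "won_items w b i = {j. w b j = i}"

definition SIA_utility ::
    "(('n::finite, 'm::finite) bids \<Rightarrow> 'm \<Rightarrow> 'n) \<Rightarrow> ('n \<Rightarrow> 'm set \<Rightarrow> real) \<Rightarrow>
     'n \<Rightarrow> ('n, 'm) bids \<Rightarrow> real" where
  "SIA_utility w v i b = v i (won_items w b i) - (\<Sum>j\<in>won_items w b i. b i j)"

definition social_welfare ::
    "('n::finite \<Rightarrow> 'm::finite set \<Rightarrow> real) \<Rightarrow> ('n \<Rightarrow> 'm set) \<Rightarrow> real" where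
  "social_welfare v A = (\<Sum>i\<in>UNIV. v i (A i))"

definition optimal_welfare :: "('n::finite \<Rightarrow> 'm::finite set \<Rightarrow> real) \<Rightarrow> real" where
  "optimal_welfare v = Max (social_welfare v ` {A. disjoint_family A})"

text \<open>Bids are nonnegative. Integrability of the equilibrium utilities is no restriction:
  utilities are bounded above, and an expected utility of \<open>-\<infinity>\<close> would make
  bidding zero a profitable deviation.\<close>

definition coarse_correlated_equilibrium ::
    "(('n::finite, 'm::finite) bids \<Rightarrow> 'm \<Rightarrow> 'n) \<Rightarrow> ('n \<Rightarrow> 'm set \<Rightarrow> real) \<Rightarrow>
     ('n, 'm) bids measure \<Rightarrow> bool" where
  "coarse_correlated_equilibrium w v M \<longleftrightarrow>
     prob_space M \<and> sets M = sets bid_space \<and>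
     (AE b in M. \<forall>i j. 0 \<le> b i j) \<and>
     (\<forall>i. integrable M (SIA_utility w v i)) \<and>
     (\<forall>i b'. (\<forall>j. 0 \<le> b' j) \<longrightarrow>
        (\<integral>b. SIA_utility w v i (b(i := b')) \<partial>M) \<le> (\<integral>b. SIA_utility w v i b \<partial>M))"

definition expected_welfare ::
    "(('n::finite, 'm::finite) bids \<Rightarrow> 'm \<Rightarrow> 'n) \<Rightarrow> ('n \<Rightarrow> 'm set \<Rightarrow> real) \<Rightarrow>
     ('n, 'm) bids measure \<Rightarrow> real" where
  "expected_welfare w v M = (\<integral>b. social_welfare v (won_items w b) \<partial>M)"

text \<open>The supremum is taken in \<^typ>\<open>ennreal\<close>, where \<open>0 / 0 = 0\<close> and
  \<open>x / 0 = \<infinity>\<close> for \<open>x > 0\<close>.\<close>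

definition price_of_anarchy_CCE ::
    "(('n::finite, 'm::finite) bids \<Rightarrow> 'm \<Rightarrow> 'n) \<Rightarrow> ('m set \<Rightarrow> real) set \<Rightarrow> ennreal" where
  "price_of_anarchy_CCE w F =
     (SUP (v, M) \<in> {(v, M). (\<forall>i. v i \<in> F) \<and> coarse_correlated_equilibrium w v M}.
        ennreal (optimal_welfare v) / ennreal (expected_welfare w v M))"

definition H :: "real \<Rightarrow> real" where
  "H x = (\<Sum>k\<in>{k::int. 1 \<le> k \<and> of_int k \<le> x}. 1 / of_int k)"

end

theory Submission
  imports Defs
begin

text \<open>
  Applying the width bound twice gives \<open>f S \<le> f A + f (S - A) + f C\<close> for every \<open>A \<subseteq> S\<close>, with some
  \<open>C \<subseteq> S\<close> of size at most \<open>2 * d\<close>. Hence, for \<open>\<alpha> = 1 - 1 / (4 * d)\<close>, either a set of at most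
  \<open>2 * d\<close> items already has value \<open>\<alpha> * f S\<close>, or \<open>f A + f (S - A) \<ge> (1 - \<alpha>) * f S\<close> for all \<open>A\<close>.
  In the first case a bidder with optimal bundle \<open>S\<close> deviates to a uniform bid on the small set. In
  the second case it bids an independent sample of the equilibrium prices, as in the argument of
  Feldman, Fu, Gravin and Lucier for subadditive bidders. Either way its equilibrium utility is at
  least \<open>f S / (8 * d)\<close> minus the expected price of \<open>S\<close>. Summing over bidders, the prices cancel
  against the payments. This bounds the price of anarchy by \<open>8 * d\<close>, and the harmonic factor is at
  least 1 because \<open>2 * d \<le> m\<close>.
\<close>

section \<open>Valuations of bounded superadditive width\<close>

text \<open>A set \<open>T\<close> of more than \<open>d\<close> items is not superadditive, so some
  proper subset has at least as large a marginal for \<open>S\<close>. Descending through such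
  subsets ends at size at most \<open>d\<close>.\<close>

lemma SAW_class_marginal_le_small_subset:
  assumes f: "f \<in> SAW_class d" and disj: "S \<inter> T = {}"
  shows "\<exists>T'\<subseteq>T. card T' \<le> d \<and> marginal f S T \<le> marginal f S T'"
  using disj
proof (induction "card T" arbitrary: T rule: less_induct)
  case less
  show ?case
  proof (cases "card T \<le> d")
    case True
    then show ?thesis by blast
  next
    case False
    have "SAW f \<le> d" using f by (simp add: SAW_class_def)
    then have "card T' \<le> d" if "T' \<noteq> {}" "superadditive_set f T'" for T'
      using that unfolding SAW_def by (subst (asm) Max_le_iff) auto
    moreover from False have ne: "T \<noteq> {}" by auto
    ultimately have "\<not> superadditive_set f T" using False by blast
    moreover have "S \<subseteq> UNIV - T" using less.prems by blast
    ultimately have le: "marginal f S T \<le> Max {marginal f S T' |T'. T' \<subset> T}"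
      unfolding superadditive_set_def by (metis (no_types) leI)
    have "Max {marginal f S T' |T'. T' \<subset> T} \<in> {marginal f S T' |T'. T' \<subset> T}"
      by (rule Max_in) (use ne in auto)
    then obtain T1 where "T1 \<subset> T" "Max {marginal f S T' |T'. T' \<subset> T} = marginal f S T1"
      by blast
    then have T1: "T1 \<subset> T" "marginal f S T \<le> marginal f S T1"
      using le by simp_all
    have "card T1 < card T" using T1(1) by (simp add: psubset_card_mono)
    moreover have "S \<inter> T1 = {}" using T1(1) less.prems by blast
    ultimately obtain T' where T': "T' \<subseteq> T1" "card T' \<le> d" "marginal f S T1 \<le> marginal f S T'"
      using less.hyps[of T1] by blast
    have "T' \<subseteq> T" "marginal f S T \<le> marginal f S T'" using T1 T' by auto
    then show ?thesis using T'(2) by blast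
  qed
qed

text \<open>First \<open>A\<close> is shrunk to \<open>A'\<close> as the conditioning set for
  \<open>S - A\<close>; then the roles are swapped and \<open>S - A\<close> is shrunk to
  \<open>B'\<close> for \<open>A'\<close>. The two inequalities telescope with
  \<open>C = A' \<union> B'\<close>.\<close>

lemma SAW_class_split_le:
  assumes f: "f \<in> SAW_class d" and "A \<subseteq> S"
  obtains C where "C \<subseteq> S" "card C \<le> 2 * d" "f S \<le> f A + f (S - A) + f C"
proof -
  have nonneg: "0 \<le> f X" for X
    using f by (simp add: SAW_class_def valuation_def)
  obtain A' where A': "A' \<subseteq> A" "card A' \<le> d" "marginal f (S - A) A \<le> marginal f (S - A) A'"
    using SAW_class_marginal_le_small_subset[OF f, of "S - A" A] by blast
  obtain B' where B': "B' \<subseteq> S - A" "card B' \<le> d" "marginal f A' (S - A) \<le> marginal f A' B'"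
    using SAW_class_marginal_le_small_subset[OF f, of A' "S - A"] A'(1) by blast
  have "(S - A) \<union> A = S" using \<open>A \<subseteq> S\<close> by blast
  then have "f S \<le> f A + f (S - A) + f (A' \<union> B')"
    using A'(3) B'(3) nonneg[of A'] nonneg[of B'] by (simp add: marginal_def Un_commute)
  moreover have "card (A' \<union> B') \<le> 2 * d"
    using card_Un_le[of A' B'] A'(2) B'(2) by linarith
  ultimately show ?thesis
    using that[of "A' \<union> B'"] A'(1) B'(1) \<open>A \<subseteq> S\<close> by blast
qed

text \<open>The component attaining the maximum at \<open>S\<close> supports \<open>v\<close> from
  below. The width bound holds for this component, not necessarily for \<open>v\<close>, and lower
  bounds on it pass to \<open>v\<close>.\<close>

lemma max_classE:
  assumes "v \<in> max_class F"
  obtains g where "g \<in> F" "g S = v S" "\<And>T. g T \<le> v T"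
proof -
  obtain k :: nat and g where k: "1 \<le> k" and g: "\<forall>i\<in>{1..k}. g i \<in> F"
    and v: "\<forall>S. v S = Max ((\<lambda>i. g i S) ` {1..k})"
    using assms unfolding max_class_def by blast
  have "Max ((\<lambda>i. g i S) ` {1..k}) \<in> (\<lambda>i. g i S) ` {1..k}"
    by (rule Max_in) (use k in auto)
  then obtain i where i: "i \<in> {1..k}" "g i S = v S" using v by auto
  have "g i T \<le> v T" for T using i(1) v by (simp add: Max_ge)
  then show ?thesis using that[of "g i"] i g by blast
qed

lemma valuation_max_class_SAW_class:
  assumes "v \<in> max_class (SAW_class d)"
  shows "valuation v"
proof -
  obtain g0 where g0: "g0 \<in> SAW_class d" "g0 {} = v {}" "\<And>T. g0 T \<le> v T"
    using max_classE[OF assms, of "{}"] by metis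
  have "v {} = 0" using g0 by (simp add: SAW_class_def valuation_def)
  moreover have "0 \<le> v T" for T
    using g0(1) g0(3)[of T] order_trans[of 0 "g0 T" "v T"] by (simp add: SAW_class_def valuation_def)
  moreover have "mono v"
  proof (rule monoI)
    fix A B :: "'a set" assume AB: "A \<subseteq> B"
    obtain g where g: "g \<in> SAW_class d" "g A = v A" "\<And>T. g T \<le> v T"
      using max_classE[OF assms, of A] by metis
    have "g A \<le> g B" using g(1) AB by (auto simp: SAW_class_def valuation_def dest: monoD)
    then show "v A \<le> v B" using g(2) g(3)[of B] by simp
  qed
  ultimately show ?thesis by (simp add: valuation_def)
qed

section \<open>Deviations in the simultaneous item auction\<close>

text \<open>Under \<open>highest_bidder_rule\<close> this is the highest bid on the item, hence its
  price. A deviator's own old bid is included, so beating it is sufficient for winning.\<close>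

definition winning_bid ::
    "(('n::finite, 'm::finite) bids \<Rightarrow> 'm \<Rightarrow> 'n) \<Rightarrow> ('n, 'm) bids \<Rightarrow> 'm \<Rightarrow> real" where
  "winning_bid w b j = b (w b j) j"

text \<open>A winner other than \<open>i\<close> would still hold an old bid, which is below
  \<open>b' j\<close>. The strict inequality makes this independent of tie-breaking.\<close>

lemma outbid_subset_won_items:
  assumes "highest_bidder_rule w"
  shows "{j. winning_bid w b j < b' j} \<subseteq> won_items w (b(i := b')) i"
proof
  fix j assume j: "j \<in> {j. winning_bid w b j < b' j}"
  have top: "b k j \<le> b (w b j) j" for b k
    using assms by (simp add: highest_bidder_rule_def)
  have "w (b(i := b')) j = i"
    using j top[of b "w (b(i := b')) j"] top[of "b(i := b')" i]
    by (auto simp: winning_bid_def split: if_splits)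
  then show "j \<in> won_items w (b(i := b')) i" by (simp add: won_items_def)
qed

text \<open>Every item has exactly one winner, so grouping payments by winner yields the total of
  all prices.\<close>

lemma sum_SIA_utility:
  "(\<Sum>i\<in>UNIV. SIA_utility w v i b)
     = social_welfare v (won_items w b) - (\<Sum>j\<in>UNIV. winning_bid w b j)"
proof -
  have "(\<Sum>i\<in>UNIV. \<Sum>j\<in>won_items w b i. b i j)
      = (\<Sum>i\<in>UNIV. \<Sum>j\<in>{j\<in>UNIV. w b j = i}. winning_bid w b j)"
    by (intro sum.cong) (auto simp: won_items_def winning_bid_def)
  also have "\<dots> = (\<Sum>j\<in>UNIV. winning_bid w b j)"
    by (rule sum.group) auto
  finally show ?thesis
    by (simp add: SIA_utility_def social_welfare_def sum_subtractf)
qed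

text \<open>With \<open>x = c / (4 * d)\<close>, winning all of \<open>C\<close> costs at most
  \<open>2 * d * x = c / 2\<close>. Otherwise some item of \<open>C\<close> has price at least
  \<open>x\<close>, and at most \<open>2 * d - 1\<close> items of \<open>C\<close> are paid for; the
  factor \<open>4 * d - 1\<close> comes from
  \<open>c / 2 - (4 * d - 1) * x = - (2 * d - 1) * x\<close>.\<close>

lemma utility_bundle_bid:
  fixes w :: "('n::finite, 'm::finite) bids \<Rightarrow> 'm \<Rightarrow> 'n"
  assumes w: "highest_bidder_rule w" and v: "valuation (v i)"
    and r: "\<And>j. 0 \<le> winning_bid w b j"
    and d: "1 \<le> d" and C: "C \<subseteq> S" "card C \<le> 2 * d"
    and c: "0 \<le> c" "c \<le> v i C"
  shows "c / 2 - (4 * real d - 1) * (\<Sum>j\<in>S. winning_bid w b j)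
       \<le> SIA_utility w v i (b(i := (\<lambda>j. if j \<in> C then c / (4 * real d) else 0)))"
proof -
  define x where "x = c / (4 * real d)"
  define b' where "b' = (\<lambda>j. if j \<in> C then x else 0)"
  define W where "W = won_items w (b(i := b')) i"
  have x: "0 \<le> x" "c = 4 * real d * x" using c d by (auto simp: x_def)
  have u: "SIA_utility w v i (b(i := b')) = v i W - real (card (W \<inter> C)) * x"
    by (simp add: SIA_utility_def W_def b'_def sum.If_cases)
  have R: "winning_bid w b j \<le> (\<Sum>j\<in>S. winning_bid w b j)" if "j \<in> S" for j
    by (rule member_le_sum) (use r that in auto)
  have R0: "0 \<le> (\<Sum>j\<in>S. winning_bid w b j)" by (simp add: r sum_nonneg)
  have "c / 2 - (4 * real d - 1) * (\<Sum>j\<in>S. winning_bid w b j) \<le> v i W - real (card (W \<inter> C)) * x"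
  proof (cases "C \<subseteq> W")
    case True
    then have "c \<le> v i W" using v c by (meson monoD order_trans valuation_def)
    moreover have "real (card (W \<inter> C)) * x \<le> 2 * real d * x"
      using C(2) True x by (intro mult_right_mono) (auto simp: Int_absorb1)
    moreover have "0 \<le> (4 * real d - 1) * (\<Sum>j\<in>S. winning_bid w b j)"
      using d R0 by (intro mult_nonneg_nonneg) auto
    ultimately show ?thesis using x by linarith
  next
    case False
    then obtain j where j: "j \<in> C" "j \<notin> W" by blast
    then have "x \<le> winning_bid w b j"
      using outbid_subset_won_items[OF w, of b b' i] by (force simp: W_def b'_def)
    then have "x \<le> (\<Sum>j\<in>S. winning_bid w b j)" using R[of j] j C(1) by force
    then have "(4 * real d - 1) * x \<le> (4 * real d - 1) * (\<Sum>j\<in>S. winning_bid w b j)"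
      using d by (intro mult_left_mono) auto
    moreover have "card (W \<inter> C) < card C"
      using j by (intro psubset_card_mono) auto
    then have "real (card (W \<inter> C)) \<le> 2 * real d - 1" using C(2) by linarith
    then have "real (card (W \<inter> C)) * x \<le> (2 * real d - 1) * x"
      using x by (intro mult_right_mono)
    moreover have "0 \<le> v i W" using v by (simp add: valuation_def)
    ultimately show ?thesis using x(2) by (simp add: algebra_simps)
  qed
  then show ?thesis using u unfolding b'_def x_def by linarith
qed

text \<open>The surcharge \<open>e\<close> turns ties with the guessed prices \<open>p\<close> into
  strict wins. The payment is bounded by the sum of all bids, whichever items are won; items outside
  \<open>S\<close> cost nothing.\<close>

lemma utility_price_bid:
  fixes w :: "('n::finite, 'm::finite) bids \<Rightarrow> 'm \<Rightarrow> 'n"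
  assumes w: "highest_bidder_rule w" and v: "valuation (v i)"
    and p: "\<And>j. 0 \<le> p j" and "0 < e"
  shows "v i {j\<in>S. winning_bid w b j \<le> p j} - (\<Sum>j\<in>S. p j + e)
       \<le> SIA_utility w v i (b(i := (\<lambda>j. if j \<in> S then p j + e else 0)))"
proof -
  define b' where "b' = (\<lambda>j. if j \<in> S then p j + e else 0)"
  define W where "W = won_items w (b(i := b')) i"
  have "{j\<in>S. winning_bid w b j \<le> p j} \<subseteq> {j. winning_bid w b j < b' j}"
    using \<open>0 < e\<close> by (auto simp: b'_def)
  also have "\<dots> \<subseteq> W" unfolding W_def by (rule outbid_subset_won_items[OF w])
  finally have "v i {j\<in>S. winning_bid w b j \<le> p j} \<le> v i W"
    using v by (simp add: monoD valuation_def)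
  moreover have "(\<Sum>j\<in>W. b' j) \<le> (\<Sum>j\<in>S. p j + e)"
  proof -
    have "(\<Sum>j\<in>W. b' j) = (\<Sum>j\<in>W \<inter> S. p j + e)"
      by (simp add: b'_def sum.If_cases)
    also have "\<dots> \<le> (\<Sum>j\<in>S. p j + e)"
      using p \<open>0 < e\<close> by (intro sum_mono2) (auto intro: add_nonneg_nonneg less_imp_le)
    finally show ?thesis .
  qed
  ultimately show ?thesis by (simp add: SIA_utility_def W_def b'_def)
qed

section \<open>Coarse correlated equilibria\<close>

lemma borel_measurable_finite_set:
  fixes h :: "'m::finite set \<Rightarrow> real"
  assumes "\<And>j. Measurable.pred N (\<lambda>x. j \<in> T x)"
  shows "(\<lambda>x. h (T x)) \<in> borel_measurable N"
proof -
  have "T \<in> measurable N (count_space UNIV)"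
  proof (rule measurable_count_space_eq2[THEN iffD2], simp, intro conjI ballI)
    fix A :: "'m set"
    have "Measurable.pred N (\<lambda>x. \<forall>j. j \<in> T x \<longleftrightarrow> j \<in> A)"
      using assms by measurable
    then show "T -` {A} \<inter> space N \<in> sets N"
      by (simp add: pred_def vimage_def Int_def set_eq_iff conj_commute)
  qed auto
  then show ?thesis by (rule measurable_compose) simp
qed

lemma integrable_finite_set:
  fixes h :: "'m::finite set \<Rightarrow> real"
  assumes "finite_measure N" "\<And>j. Measurable.pred N (\<lambda>x. j \<in> T x)"
  shows "integrable N (\<lambda>x. h (T x))"
proof (rule finite_measure.integrable_const_bound[OF assms(1)])
  have "\<bar>h X\<bar> \<le> (\<Sum>A\<in>UNIV. \<bar>h A\<bar>)" for X
    by (rule member_le_sum) auto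
  then show "AE x in N. norm (h (T x)) \<le> (\<Sum>A\<in>UNIV. \<bar>h A\<bar>)" by simp
  show "(\<lambda>x. h (T x)) \<in> borel_measurable N"
    by (rule borel_measurable_finite_set) (rule assms)
qed

locale SIA_CCE =
  fixes w :: "('n::finite, 'm::finite) bids \<Rightarrow> 'm \<Rightarrow> 'n"
    and v :: "'n \<Rightarrow> 'm set \<Rightarrow> real"
    and M :: "('n, 'm) bids measure"
  assumes rule: "highest_bidder_rule w"
    and val: "\<And>i. valuation (v i)"
    and cce: "coarse_correlated_equilibrium w v M"
begin

sublocale prob_space M
  using cce by (simp add: coarse_correlated_equilibrium_def)

lemma sets_M [measurable_cong]: "sets M = sets bid_space"
  using cce by (simp add: coarse_correlated_equilibrium_def)

lemma w_measurable [measurable]: "(\<lambda>b. w b j) \<in> measurable bid_space (count_space UNIV)"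
  using rule by (simp add: highest_bidder_rule_def)

lemma bid_measurable [measurable]: "(\<lambda>b. b i j) \<in> borel_measurable bid_space"
proof -
  have "(\<lambda>b. b i) \<in> measurable bid_space (\<Pi>\<^sub>M j\<in>UNIV. borel)"
    unfolding bid_space_def by (rule measurable_component_singleton) simp
  then show ?thesis
    by (rule measurable_compose) (rule measurable_component_singleton, simp)
qed

lemma winning_bid_measurable [measurable]:
  "(\<lambda>b. winning_bid w b j) \<in> borel_measurable bid_space"
  unfolding winning_bid_def
  by (rule measurable_compose_countable[where g = "\<lambda>b. w b j" and f = "\<lambda>k b. b k j"]) measurable

lemma deviate_measurable [measurable]: "(\<lambda>b. b(i := b')) \<in> measurable bid_space bid_space"
  unfolding bid_space_def
proof (rule measurable_PiM_single')
  show "(\<lambda>b. (b(i := b')) k) \<in> measurable (\<Pi>\<^sub>M i\<in>UNIV. \<Pi>\<^sub>M j\<in>UNIV. borel) (\<Pi>\<^sub>M j\<in>UNIV. borel)" for k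
    by (cases "k = i") (simp_all add: space_PiM PiE_def extensional_def)
qed (auto simp: space_PiM PiE_def extensional_def)

lemma won_items_measurable [measurable]:
  "Measurable.pred bid_space (\<lambda>b. j \<in> won_items w b i)"
  unfolding won_items_def by simp

text \<open>Since \<open>b'\<close> is fixed, the deviator's utility depends only on the set won and
  takes finitely many values.\<close>

lemma integrable_deviation: "integrable M (\<lambda>b. SIA_utility w v i (b(i := b')))"
proof -
  have "integrable M (\<lambda>b. (\<lambda>X. v i X - (\<Sum>j\<in>X. b' j)) (won_items w (b(i := b')) i))"
    by (rule integrable_finite_set) (unfold_locales, measurable)
  then show ?thesis by (simp add: SIA_utility_def)
qed

lemma best_response:
  assumes "\<And>j. 0 \<le> b' j" "integrable M g"
    and "AE b in M. g b \<le> SIA_utility w v i (b(i := b'))"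
  shows "(\<integral>b. g b \<partial>M) \<le> (\<integral>b. SIA_utility w v i b \<partial>M)"
proof -
  have "(\<integral>b. g b \<partial>M) \<le> (\<integral>b. SIA_utility w v i (b(i := b')) \<partial>M)"
    by (rule integral_mono_AE[OF assms(2) integrable_deviation assms(3)])
  also have "\<dots> \<le> (\<integral>b. SIA_utility w v i b \<partial>M)"
    using cce assms(1) by (simp add: coarse_correlated_equilibrium_def)
  finally show ?thesis .
qed

lemma expected_utility_nonneg: "0 \<le> (\<integral>b. SIA_utility w v i b \<partial>M)"
proof -
  have "0 \<le> SIA_utility w v i (b(i := (\<lambda>_. 0)))" for b
    using val[of i] by (simp add: SIA_utility_def valuation_def)
  then show ?thesis using best_response[of "\<lambda>_. 0" "\<lambda>_. 0" i] by simp
qed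

lemma AE_winning_bid_nonneg: "AE b in M. \<forall>j. 0 \<le> winning_bid w b j"
proof -
  have "AE b in M. \<forall>i j. 0 \<le> b i j"
    using cce by (simp add: coarse_correlated_equilibrium_def)
  then show ?thesis by eventually_elim (simp add: winning_bid_def)
qed

lemma integrable_utility: "integrable M (SIA_utility w v i)"
  using cce by (simp add: coarse_correlated_equilibrium_def)

lemma integrable_welfare: "integrable M (\<lambda>b. social_welfare v (won_items w b))"
  unfolding social_welfare_def
  by (intro Bochner_Integration.integrable_sum integrable_finite_set) (unfold_locales, measurable)

text \<open>Revenue is welfare minus total utility, hence integrable, and it dominates each single
  price because prices are almost surely nonnegative.\<close>

lemma integrable_winning_bid: "integrable M (\<lambda>b. winning_bid w b j)"
proof (rule Bochner_Integration.integrable_bound)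
  show "integrable M (\<lambda>b. social_welfare v (won_items w b) - (\<Sum>i\<in>UNIV. SIA_utility w v i b))"
    by (intro Bochner_Integration.integrable_diff integrable_welfare
        Bochner_Integration.integrable_sum integrable_utility)
  show "(\<lambda>b. winning_bid w b j) \<in> borel_measurable M" by measurable
  show "AE b in M. norm (winning_bid w b j)
      \<le> norm (social_welfare v (won_items w b) - (\<Sum>i\<in>UNIV. SIA_utility w v i b))"
    using AE_winning_bid_nonneg
  proof eventually_elim
    case (elim b)
    then have "winning_bid w b j \<le> (\<Sum>j\<in>UNIV. winning_bid w b j)"
      by (intro member_le_sum) auto
    moreover have "0 \<le> winning_bid w b j" using elim by simp
    ultimately show ?case by (simp add: sum_SIA_utility)
  qed
qed

section \<open>Lower bounds on equilibrium utilities\<close>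

lemma expected_utility_ge_of_bundle:
  assumes d: "1 \<le> d" and C: "C \<subseteq> S" "card C \<le> 2 * d" and c: "0 \<le> c" "c \<le> v i C"
  shows "c / 2 - (4 * real d - 1) * (\<Sum>j\<in>S. \<integral>b. winning_bid w b j \<partial>M)
       \<le> (\<integral>b. SIA_utility w v i b \<partial>M)"
proof -
  let ?g = "\<lambda>b. c / 2 - (4 * real d - 1) * (\<Sum>j\<in>S. winning_bid w b j)"
  let ?b' = "\<lambda>j. if j \<in> C then c / (4 * real d) else 0"
  have "(\<integral>b. ?g b \<partial>M) \<le> (\<integral>b. SIA_utility w v i b \<partial>M)"
  proof (rule best_response)
    show "0 \<le> ?b' j" for j using c d by simp
    show "integrable M ?g"
      by (intro Bochner_Integration.integrable_diff integrable_mult_right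
          Bochner_Integration.integrable_sum integrable_winning_bid) simp
    show "AE b in M. ?g b \<le> SIA_utility w v i (b(i := ?b'))"
      using AE_winning_bid_nonneg
      by eventually_elim (rule utility_bundle_bid[where v = v and i = i, OF rule val _ d C c], simp)
  qed
  moreover have "(\<integral>b. ?g b \<partial>M)
      = c / 2 - (4 * real d - 1) * (\<Sum>j\<in>S. \<integral>b. winning_bid w b j \<partial>M)"
    by (simp add: integrable_winning_bid prob_space)
  ultimately show ?thesis by simp
qed

text \<open>The deviation is to bid the winning prices of an independent copy of the equilibrium.
  By symmetry either of the two price vectors is the larger one equally often, so the deviator
  wins a set and its complement in \<open>S\<close> with the same weight.\<close>

lemma expected_utility_ge_of_subadditive:
  assumes c: "\<And>A. A \<subseteq> S \<Longrightarrow> c \<le> v i A + v i (S - A)"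
  shows "c / 2 - (\<Sum>j\<in>S. \<integral>b. winning_bid w b j \<partial>M) \<le> (\<integral>b. SIA_utility w v i b \<partial>M)"
proof -
  interpret P: pair_prob_space M M ..
  let ?E = "\<integral>b. SIA_utility w v i b \<partial>M"
  let ?R = "\<Sum>j\<in>S. \<integral>b. winning_bid w b j \<partial>M"
  \<comment> \<open>The value of the items in \<open>S\<close> whose price under \<open>b\<close> is
    met by the sampled price under \<open>b'\<close>.\<close>
  define h where "h b' b = v i {j\<in>S. winning_bid w b j \<le> winning_bid w b' j}" for b' b
  have int_h: "integrable (M \<Otimes>\<^sub>M M) (\<lambda>(b', b). h b' b)"
    unfolding h_def split_beta'
    by (rule integrable_finite_set) (unfold_locales, measurable)
  have int_h': "integrable (M \<Otimes>\<^sub>M M) (\<lambda>(b', b). h b b')"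
    unfolding h_def split_beta'
    by (rule integrable_finite_set) (unfold_locales, measurable)
  have int_h1: "integrable M (\<lambda>b. h b' b)" for b'
    unfolding h_def
    by (rule integrable_finite_set) (unfold_locales, measurable)
  define I where "I = (\<integral>b'. (\<integral>b. h b' b \<partial>M) \<partial>M)"
  have "c \<le> (\<integral>x. (case x of (b', b) \<Rightarrow> h b' b) + (case x of (b', b) \<Rightarrow> h b b') \<partial>(M \<Otimes>\<^sub>M M))"
  proof -
    have "c \<le> h b' b + h b b'" for b b'
    proof -
      let ?A = "{j\<in>S. winning_bid w b j \<le> winning_bid w b' j}"
      \<comment> \<open>Ties count for both sides, so the two sets cover \<open>S\<close>.\<close>
      have "S - ?A \<subseteq> {j\<in>S. winning_bid w b' j \<le> winning_bid w b j}" by auto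
      then have "v i (S - ?A) \<le> h b b'"
        unfolding h_def using val[of i] by (simp add: monoD valuation_def)
      then show ?thesis using c[of ?A] by (simp add: h_def)
    qed
    then have "(\<integral>x. c \<partial>(M \<Otimes>\<^sub>M M))
        \<le> (\<integral>x. (case x of (b', b) \<Rightarrow> h b' b) + (case x of (b', b) \<Rightarrow> h b b') \<partial>(M \<Otimes>\<^sub>M M))"
      by (intro integral_mono Bochner_Integration.integrable_add int_h int_h') auto
    then show ?thesis by (simp add: P.prob_space)
  qed
  also have "\<dots> = I + (\<integral>b'. (\<integral>b. h b b' \<partial>M) \<partial>M)"
    unfolding I_def
    by (simp add: Bochner_Integration.integral_add[OF int_h int_h']
        P.integral_fst[OF int_h] P.integral_fst[OF int_h'])
  \<comment> \<open>The two copies have the same law, so exchanging them by Fubini identifies both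
    halves.\<close>
  also have "(\<integral>b'. (\<integral>b. h b b' \<partial>M) \<partial>M) = I"
    unfolding I_def by (rule P.Fubini_integral[OF int_h])
  finally have I: "c / 2 \<le> I" by simp
  have bound: "I - ?R - real (card S) * e \<le> ?E" if e: "0 < e" for e
  proof -
    \<comment> \<open>For a fixed sample \<open>b'\<close> the deviation is deterministic, so the
      equilibrium condition applies; averaging over \<open>b'\<close> comes afterwards. The
      exceptional null set is where the sampled bids could be negative.\<close>
    have "AE b' in M. (\<integral>b. h b' b \<partial>M) - (\<Sum>j\<in>S. winning_bid w b' j + e) \<le> ?E"
      using AE_winning_bid_nonneg
    proof eventually_elim
      case (elim b')
      let ?s = "\<Sum>j\<in>S. winning_bid w b' j + e"
      have "(\<integral>b. h b' b - ?s \<partial>M) \<le> ?E"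
      proof (rule best_response[where b' = "\<lambda>j. if j \<in> S then winning_bid w b' j + e else 0"])
        show "0 \<le> (if j \<in> S then winning_bid w b' j + e else 0)" for j
          using elim[rule_format, of j] e by simp
        show "integrable M (\<lambda>b. h b' b - ?s)" by (simp add: int_h1)
        show "AE b in M. h b' b - ?s
            \<le> SIA_utility w v i (b(i := \<lambda>j. if j \<in> S then winning_bid w b' j + e else 0))"
          unfolding h_def using utility_price_bid[of w v i, OF rule val _ e] elim by (intro AE_I2) simp
      qed
      then show ?case by (simp add: int_h1 prob_space)
    qed
    then have "(\<integral>b'. (\<integral>b. h b' b \<partial>M) - (\<Sum>j\<in>S. winning_bid w b' j + e) \<partial>M) \<le> (\<integral>b'. ?E \<partial>M)"
      by (intro integral_mono_AE Bochner_Integration.integrable_diff P.integrable_fst[OF int_h]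
          Bochner_Integration.integrable_sum Bochner_Integration.integrable_add
          integrable_winning_bid) auto
    then show ?thesis
      by (simp add: I_def P.integrable_fst[OF int_h] integrable_winning_bid prob_space sum.distrib)
  qed
  have "I - ?R \<le> ?E"
  proof (rule field_le_epsilon)
    fix e :: real assume e: "0 < e"
    \<comment> \<open>The \<open>+ 1\<close> keeps the denominator positive when \<open>S\<close> is
      empty.\<close>
    have "real (card S) * (e / (real (card S) + 1)) \<le> e"
      using e by (simp add: field_simps)
    then show "I - ?R \<le> ?E + e"
      using bound[of "e / (real (card S) + 1)"] e by simp
  qed
  then show ?thesis using I by linarith
qed

lemma expected_utility_ge:
  assumes d: "1 \<le> d" and v: "v i \<in> max_class (SAW_class d)"
  shows "v i S / (8 * real d) - (\<Sum>j\<in>S. \<integral>b. winning_bid w b j \<partial>M)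
       \<le> (\<integral>b. SIA_utility w v i b \<partial>M)"
proof -
  let ?R = "\<Sum>j\<in>S. \<integral>b. winning_bid w b j \<partial>M"
  \<comment> \<open>This threshold balances the cases: \<open>?a / 2 = (4 * d - 1) / (8 * d)\<close>
    cancels the price factor of the bundle bid, and
    \<open>(1 - ?a) / 2 = 1 / (8 * d)\<close>.\<close>
  let ?a = "1 - 1 / (4 * real d)"
  obtain g where g: "g \<in> SAW_class d" "g S = v i S" "\<And>T. g T \<le> v i T"
    using max_classE[OF v, of S] by metis
  have a: "0 \<le> ?a" using d by simp
  have vS: "0 \<le> v i S" using val[of i] by (simp add: valuation_def)
  show ?thesis
  proof (cases "\<exists>C\<subseteq>S. card C \<le> 2 * d \<and> ?a * v i S \<le> v i C")
    case True
    then obtain C where C: "C \<subseteq> S" "card C \<le> 2 * d" "?a * v i S \<le> v i C" by blast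
    have "0 \<le> ?a * v i S" using a vS by (rule mult_nonneg_nonneg)
    from expected_utility_ge_of_bundle[OF d C(1,2) this C(3)]
    have "?a * v i S / 2 - (4 * real d - 1) * ?R \<le> (\<integral>b. SIA_utility w v i b \<partial>M)" .
    moreover have "?a * v i S / 2 = (4 * real d - 1) * (v i S / (8 * real d))"
      using d by (simp add: field_simps)
    ultimately have le: "(4 * real d - 1) * (v i S / (8 * real d) - ?R) \<le> (\<integral>b. SIA_utility w v i b \<partial>M)"
      by (simp add: right_diff_distrib)
    \<comment> \<open>The factor \<open>4 * d - 1 \<ge> 1\<close> may be dropped only from a
      nonnegative quantity; in the other case nonnegativity of the utility suffices.\<close>
    show ?thesis
    proof (cases "v i S / (8 * real d) \<le> ?R")
      case True
      then show ?thesis using expected_utility_nonneg[of i] by linarith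
    next
      case False
      then have "1 * (v i S / (8 * real d) - ?R) \<le> (4 * real d - 1) * (v i S / (8 * real d) - ?R)"
        using d by (intro mult_right_mono) auto
      then show ?thesis using le unfolding mult_1 by (rule order_trans)
    qed
  next
    case False
    have "v i S / (4 * real d) \<le> v i A + v i (S - A)" if A: "A \<subseteq> S" for A
    proof -
      obtain C where C: "C \<subseteq> S" "card C \<le> 2 * d" "g S \<le> g A + g (S - A) + g C"
        using SAW_class_split_le[OF g(1) A] by blast
      \<comment> \<open>The correction term \<open>g C\<close> takes less than the fraction
        \<open>?a\<close> of \<open>g S = v i S\<close>, leaving at least \<open>1 / (4 * d)\<close>
        of it to the two parts.\<close>
      have "v i C < ?a * v i S" using False C(1,2) by force
      then show ?thesis
        using C(3) g(2) g(3)[of A] g(3)[of "S - A"] g(3)[of C] by (simp add: left_diff_distrib)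
    qed
    from expected_utility_ge_of_subadditive[OF this] show ?thesis by simp
  qed
qed

text \<open>Disjoint bundles charge each price at most once, so the summed price terms are at most
  the expected revenue, which is exactly the gap between expected welfare and total utility.\<close>

lemma optimal_welfare_le:
  assumes d: "1 \<le> d" and v: "\<And>i. v i \<in> max_class (SAW_class d)"
  shows "optimal_welfare v \<le> 8 * real d * expected_welfare w v M"
proof -
  let ?r = "\<lambda>j. \<integral>b. winning_bid w b j \<partial>M"
  have r: "0 \<le> ?r j" for j
  proof (rule integral_nonneg_AE)
    show "AE b in M. 0 \<le> winning_bid w b j"
      using AE_winning_bid_nonneg by eventually_elim simp
  qed
  have sum_u: "(\<Sum>i\<in>UNIV. \<integral>b. SIA_utility w v i b \<partial>M) = expected_welfare w v M - (\<Sum>j\<in>UNIV. ?r j)"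
  proof -
    have "(\<Sum>i\<in>UNIV. \<integral>b. SIA_utility w v i b \<partial>M) = (\<integral>b. (\<Sum>i\<in>UNIV. SIA_utility w v i b) \<partial>M)"
      by (simp add: integrable_utility)
    then show ?thesis
      by (simp add: sum_SIA_utility integrable_welfare integrable_winning_bid expected_welfare_def)
  qed
  have "social_welfare v A \<le> 8 * real d * expected_welfare w v M" if A: "disjoint_family A" for A
  proof -
    have "(\<Sum>i\<in>UNIV. \<Sum>j\<in>A i. ?r j) = (\<Sum>j\<in>(\<Union>i. A i). ?r j)"
      using A by (intro sum.UNION_disjoint[symmetric]) (auto simp: disjoint_family_on_def)
    also have "\<dots> \<le> (\<Sum>j\<in>UNIV. ?r j)"
      by (intro sum_mono2) (auto simp: r)
    finally have prices: "(\<Sum>i\<in>UNIV. \<Sum>j\<in>A i. ?r j) \<le> (\<Sum>j\<in>UNIV. ?r j)" .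
    have "(\<Sum>i\<in>UNIV. v i (A i) / (8 * real d) - (\<Sum>j\<in>A i. ?r j))
        \<le> (\<Sum>i\<in>UNIV. \<integral>b. SIA_utility w v i b \<partial>M)"
      by (intro sum_mono expected_utility_ge d v)
    then have "social_welfare v A / (8 * real d) \<le> expected_welfare w v M"
      using prices unfolding sum_u
      by (simp add: sum_subtractf social_welfare_def flip: sum_divide_distrib)
    then show ?thesis using d by (simp add: field_simps)
  qed
  moreover have "{A :: 'n \<Rightarrow> 'm set. disjoint_family A} \<noteq> {}"
    by (auto intro: exI[of _ "\<lambda>_. {}"] simp: disjoint_family_on_def)
  ultimately show ?thesis
    unfolding optimal_welfare_def by (subst Max_le_iff) auto
qed

lemma expected_welfare_nonneg: "0 \<le> expected_welfare w v M"
  unfolding expected_welfare_def social_welfare_def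
  using val by (intro integral_nonneg_AE AE_I2 sum_nonneg) (simp add: valuation_def)

end

section \<open>The harmonic factor and the final ratio\<close>

lemma H_ge_1:
  assumes "1 \<le> x"
  shows "1 \<le> H x"
proof -
  \<comment> \<open>Finiteness matters because a sum over an infinite set defaults to 0; the term
    \<open>k = 1\<close> then gives the bound.\<close>
  have "{k::int. 1 \<le> k \<and> of_int k \<le> x} = {1..\<lfloor>x\<rfloor>}"
    by (auto simp: le_floor_iff)
  then have fin: "finite {k::int. 1 \<le> k \<and> of_int k \<le> x}" by simp
  have "1 / of_int 1 \<le> H x"
    unfolding H_def by (rule member_le_sum) (use assms fin in auto)
  then show ?thesis by simp
qed

theorem theorem15:
  fixes w :: "('n::finite, 'm::finite) bids \<Rightarrow> 'm \<Rightarrow> 'n"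
    and d :: nat
  assumes "d \<ge> 1"
    and "2 * d \<le> CARD('m)"
    and "highest_bidder_rule w"
  shows "price_of_anarchy_CCE w (max_class (SAW_class d))
           \<le> ennreal (8 * real d * H (real CARD('m) / (2 * real d)))"
proof -
  let ?K = "8 * real d * H (real CARD('m) / (2 * real d))"
  \<comment> \<open>For an argument below 1 the harmonic sum would be empty, so
    \<open>2 * d \<le> CARD('m)\<close> is what permits inserting the factor.\<close>
  have "1 \<le> real CARD('m) / (2 * real d)"
    using assms(1) of_nat_mono[OF assms(2), where ?'a = real] by simp
  then have "1 \<le> H (real CARD('m) / (2 * real d))" by (rule H_ge_1)
  then have K: "8 * real d \<le> ?K" using assms(1) by simp
  have "ennreal (optimal_welfare v) / ennreal (expected_welfare w v M) \<le> ennreal ?K"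
    if v: "\<And>i. v i \<in> max_class (SAW_class d)" and M: "coarse_correlated_equilibrium w v M" for v M
  proof -
    interpret SIA_CCE w v M
      using assms(3) valuation_max_class_SAW_class[OF v] M by unfold_locales
    have le: "optimal_welfare v \<le> ?K * expected_welfare w v M"
      using optimal_welfare_le[OF assms(1) v] mult_right_mono[OF K expected_welfare_nonneg]
      by linarith
    show ?thesis
    proof (cases "expected_welfare w v M = 0")
      \<comment> \<open>Zero expected welfare forces an optimum of at most 0, so the ratio is
        \<open>0 / 0 = 0\<close> in \<open>ennreal\<close>.\<close>
      case True
      then show ?thesis using le by (simp add: ennreal_neg)
    next
      case False
      then have pos: "0 < expected_welfare w v M" using expected_welfare_nonneg by simp
      have "ennreal (optimal_welfare v) \<le> ennreal ?K * ennreal (expected_welfare w v M)"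
        using le K pos by (simp flip: ennreal_mult' add: ennreal_leI)
      then show ?thesis
        using pos by (intro divide_le_posI_ennreal) (auto simp: mult.commute)
    qed
  qed
  then show ?thesis
    unfolding price_of_anarchy_CCE_def by (intro SUP_least) auto
qed

end
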